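(* Let $\mathbb G$ be an infinite finitely generated group and let $\mu$ be a non-degenerate probability measure on $\mathbb G$ whose random walk is transient. (i) Assume that $\mu$ is symmetric and that there is a finite symmetric generating set $S\subset\operatorname{supp}\mu$ of $\mathbb G$ such that, with $\rho:=\min_{s\in S}\mu(s)>0$ and $|\cdot|$ the word length with respect to $S$, $$\sum_{g\in\mathbb G}\mu(g)\,\rho_0^{-|g|}<\infty\qquad\text{for some } 0<\rho_0<\rho .$$ If $(\mathbb G,\mu)$ is strong Liouville, then for every $a,b\in\mathbb G$ and every exhaustion $S_n\nearrow\mathbb G$ one has $\Delta(S_n;a,b)\to 0$ as $n\to\infty$. (ii) Conversely (without assuming symmetry of $\mu$ or the moment condition in (i)), if for all $a,b\in\mathbb G$ and every exhaustion $S_n\nearrow\mathbb G$ one has $\Delta(S_n;a,b)\to0$, then $(\mathbb G,\mu)$ is strong Liouville.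
   Context: A probability measure $\mu$ on $\mathbb G$ is non-degenerate if $\operatorname{supp}\mu$ generates $\mathbb G$ as a semigroup, and symmetric if $\mu(g)=\mu(g^{-1})$ for all $g$. The $\mu$-random walk is the right random walk with transition probabilities $p_n(x,y)=\mu^{(n)}(x^{-1}y)$, where $\mu^{(n)}$ is the $n$-fold convolution power and $p_0(x,y)=\delta_{xy}$. Its Green function is $G(x,y)=\sum_{n\ge0}p_n(x,y)$; transience means $G$ is finite. Fix a finite symmetric generating set $T$ of $\mathbb G$. For $S\subset\mathbb G$, the outer boundary $\partial S$ is the set of $x\notin S$ such that $x=yt$ for some $y\in S$, $t\in T$. For a finite non-empty set $S\subset\mathbb G$ and $a,b\in\mathbb G$, $$\Delta(S;a,b):=\max_{x\in\partial S}\frac{|G(a,x)-G(b,x)|}{G(a,x)}.$$ An exhaustion $S_n\nearrow\mathbb G$ is an increasing sequence of finite non-empty subsets with union $\mathbb G$. A function $f:\mathbb G\to\mathbb R$ is $\mu$-harmonic if $f(k)=\sum_{g}\mu(g)f(kg)$ for all $k\in\mathbb G$, with absolute convergence. $(\mathbb G,\mu)$ is strong Liouville if every positive $\mu$-harmonic function on $\mathbb G$ is constant. *)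

theory Defs
  imports "HOL-Probability.Probability"
begin

text \<open>
  The group is the type \<open>'a\<close> of class \<open>group_add\<close>, which is the library's class of
  not necessarily commutative groups. It is written additively: \<open>xy\<close> is \<open>x + y\<close>,
  \<open>x\<^sup>-\<^sup>1 y\<close> is \<open>- x + y\<close>, the identity is \<open>0\<close>, and the product of a word
  \<open>ws\<close> is \<open>sum_list ws\<close>. As the groups considered are finitely generated, hence
  countable, \<open>'a pmf\<close> is the type of all probability measures on the group, and
  \<open>set_pmf \<mu>\<close> is the support of \<open>\<mu>\<close>.
\<close>

section \<open>Generating sets and word length\<close>

inductive_set subgroup_gen :: "'a::group_add set \<Rightarrow> 'a set" for A :: "'a set" where
  zero: "0 \<in> subgroup_gen A"
| incl: "x \<in> A \<Longrightarrow> x \<in> subgroup_gen A"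
| minus: "x \<in> subgroup_gen A \<Longrightarrow> - x \<in> subgroup_gen A"
| plus: "x \<in> subgroup_gen A \<Longrightarrow> y \<in> subgroup_gen A \<Longrightarrow> x + y \<in> subgroup_gen A"

inductive_set semigroup_gen :: "'a::group_add set \<Rightarrow> 'a set" for A :: "'a set" where
  incl: "x \<in> A \<Longrightarrow> x \<in> semigroup_gen A"
| plus: "x \<in> semigroup_gen A \<Longrightarrow> y \<in> semigroup_gen A \<Longrightarrow> x + y \<in> semigroup_gen A"

definition finite_symmetric_generating :: "'a::group_add set \<Rightarrow> bool" where
  "finite_symmetric_generating T \<longleftrightarrow>
     finite T \<and> (\<forall>t\<in>T. - t \<in> T) \<and> subgroup_gen T = UNIV"

text \<open>Only used for symmetric \<open>S\<close>, so that inverse letters need not be added to the alphabet.\<close>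

definition word_length :: "'a::group_add set \<Rightarrow> 'a \<Rightarrow> nat" where
  "word_length S g = (LEAST n. \<exists>ws. length ws = n \<and> set ws \<subseteq> S \<and> sum_list ws = g)"


section \<open>Random walk and Green function\<close>

definition nondegenerate :: "'a::group_add pmf \<Rightarrow> bool" where
  "nondegenerate \<mu> \<longleftrightarrow> semigroup_gen (set_pmf \<mu>) = UNIV"

definition symmetric_pmf :: "'a::group_add pmf \<Rightarrow> bool" where
  "symmetric_pmf \<mu> \<longleftrightarrow> (\<forall>g. pmf \<mu> g = pmf \<mu> (- g))"

definition convolution_pmf :: "'a::group_add pmf \<Rightarrow> 'a pmf \<Rightarrow> 'a pmf" where
  "convolution_pmf \<mu> \<nu> = map_pmf (\<lambda>(x, y). x + y) (pair_pmf \<mu> \<nu>)"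

primrec convolution_power :: "'a::group_add pmf \<Rightarrow> nat \<Rightarrow> 'a pmf" where
  "convolution_power \<mu> 0 = return_pmf 0"
| "convolution_power \<mu> (Suc n) = convolution_pmf (convolution_power \<mu> n) \<mu>"

definition transition_prob :: "'a::group_add pmf \<Rightarrow> nat \<Rightarrow> 'a \<Rightarrow> 'a \<Rightarrow> real" where
  "transition_prob \<mu> n x y = pmf (convolution_power \<mu> n) (- x + y)"

text \<open>The terms are non-negative, so the Green function is finite iff the real series is
  summable. Under \<open>transient \<mu>\<close> the real-valued \<open>green \<mu>\<close> is thus the Green function.\<close>

definition transient :: "'a::group_add pmf \<Rightarrow> bool" where
  "transient \<mu> \<longleftrightarrow> (\<forall>x y. summable (\<lambda>n. transition_prob \<mu> n x y))"

definition green :: "'a::group_add pmf \<Rightarrow> 'a \<Rightarrow> 'a \<Rightarrow> real" where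
  "green \<mu> x y = (\<Sum>n. transition_prob \<mu> n x y)"


section \<open>Boundaries and exhaustions\<close>

definition outer_boundary :: "'a::group_add set \<Rightarrow> 'a set \<Rightarrow> 'a set" where
  "outer_boundary T S = {x. x \<notin> S \<and> (\<exists>y\<in>S. \<exists>t\<in>T. x = y + t)}"

text \<open>If \<open>T\<close> is a finite generating set of an infinite group and \<open>S\<close> is finite and
  non-empty, then the boundary is finite and non-empty, so that \<open>Max\<close> is meaningful.\<close>

definition green_variation ::
    "'a::group_add pmf \<Rightarrow> 'a set \<Rightarrow> 'a set \<Rightarrow> 'a \<Rightarrow> 'a \<Rightarrow> real" where
  "green_variation \<mu> T S a b =
     Max ((\<lambda>x. \<bar>green \<mu> a x - green \<mu> b x\<bar> / green \<mu> a x) ` outer_boundary T S)"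

definition exhaustion :: "(nat \<Rightarrow> 'a set) \<Rightarrow> bool" where
  "exhaustion F \<longleftrightarrow>
     incseq F \<and> (\<forall>n. finite (F n) \<and> F n \<noteq> {}) \<and> (\<Union>n. F n) = UNIV"


section \<open>Harmonic functions\<close>

definition harmonic :: "'a::group_add pmf \<Rightarrow> ('a \<Rightarrow> real) \<Rightarrow> bool" where
  "harmonic \<mu> f \<longleftrightarrow>
     (\<forall>k. (\<lambda>g. \<bar>pmf \<mu> g * f (k + g)\<bar>) summable_on UNIV \<and>
          f k = (\<Sum>\<^sub>\<infinity>g. pmf \<mu> g * f (k + g)))"

definition strong_liouville :: "'a::group_add pmf \<Rightarrow> bool" where
  "strong_liouville \<mu> \<longleftrightarrow>
     (\<forall>f. harmonic \<mu> f \<and> (\<forall>x. f x > 0) \<longrightarrow> (\<exists>c. \<forall>x. f x = c))"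

text \<open>The exponent \<open>- |g|\<close> is an integer, whence \<open>powi\<close>.\<close>

definition exp_moment_condition :: "'a::group_add pmf \<Rightarrow> bool" where
  "exp_moment_condition \<mu> \<longleftrightarrow>
     (\<exists>S. finite_symmetric_generating S \<and> S \<subseteq> set_pmf \<mu> \<and>
       (\<exists>\<rho>\<^sub>0>0. \<rho>\<^sub>0 < Min (pmf \<mu> ` S) \<and>
         (\<lambda>g. pmf \<mu> g * \<rho>\<^sub>0 powi (- int (word_length S g))) summable_on UNIV))"

end

theory Submission
  imports Defs "HOL-Complex_Analysis.Great_Picard"
begin

text \<open>
  Both directions pass through one intermediate statement: for all \<open>a\<close> and \<open>b\<close>, the relative
  difference \<open>\<bar>G(a,x) - G(b,x)\<bar> / G(a,x)\<close> tends to \<open>0\<close> as \<open>x\<close> leaves every finite set.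
  The boundary of a large set lies far out, so this makes the boundary maxima small;
  conversely, infinitely many far points with a large relative difference can be placed one by
  one on the boundaries of an exhaustion (\<open>boundary_maximum_tendsto_iff\<close>).

  Suppose that \<open>(\<G>,\<mu>)\<close> is strong Liouville, and let \<open>x\<^sub>n\<close> leave every finite set. The kernels
  \<open>K\<^sub>n(y) = G(y,x\<^sub>n) / G(0,x\<^sub>n)\<close> obey a Harnack inequality
  \<open>K\<^sub>n(y + g) \<le> \<rho>\<^sub>0\<^sup>-\<^sup>|\<^sup>g\<^sup>| K\<^sub>n(y)\<close>, because from \<open>y\<close> the walk can
  follow a shortest word for \<open>g\<close>, whose letters have probability at least \<open>\<rho>\<^sub>0\<close> each. Hence they
  are bounded at each point, and a subsequence converges pointwise to a positive limit. The
  kernel \<open>K\<^sub>n\<close> is harmonic except at \<open>x\<^sub>n\<close>, and by the moment condition the terms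
  \<open>\<mu>(g) K\<^sub>n(y + g)\<close> have a summable bound independent of \<open>n\<close>; so the limit is harmonic (\<open>green_ratio_subsequence_harmonic_limit\<close>).
  It is constant by assumption and equals \<open>1\<close> at \<open>0\<close>, so the
  quotients \<open>G(b,x\<^sub>n) / G(a,x\<^sub>n)\<close> tend to \<open>1\<close> along the subsequence.

  Conversely, a positive harmonic function \<open>f\<close> is a pointwise limit of potentials
  \<open>\<Sum>\<^sub>z G(\<cdot>,z) v\<^sub>n(z)\<close> whose charges \<open>v\<^sub>n\<close> tend to \<open>0\<close> at each point
  (\<open>harmonic_limit_of_potentials\<close>). Finitely many points therefore contribute nothing in the
  limit, and at all others \<open>G(b,z) \<le> c G(a,z)\<close>, for any given \<open>c > 1\<close>. This yields
  \<open>f(b) \<le> c f(a)\<close>, and letting \<open>c\<close> tend to \<open>1\<close> shows that \<open>f\<close> is constant. The potentials arise by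
  cutting \<open>f\<close> off at finite multiples of Green functions: the Riesz decomposition of a
  superharmonic function below a finite potential has no harmonic part
  (\<open>dominated_eq_potential\<close>).
\<close>

section \<open>Averaging operators and potentials\<close>

text \<open>
  The value \<open>\<infinity>\<close> is admitted, so that sums, potentials and their rearrangements need no
  convergence conditions. In the comments below, \<open>P u\<close> stands for \<open>averaging \<mu> u\<close>.
\<close>

definition averaging :: "'a::group_add pmf \<Rightarrow> ('a \<Rightarrow> ennreal) \<Rightarrow> 'a \<Rightarrow> ennreal" where
  "averaging \<nu> u x = (\<integral>\<^sup>+g. u (x + g) \<partial>measure_pmf \<nu>)"

definition potential :: "'a::group_add pmf \<Rightarrow> ('a \<Rightarrow> ennreal) \<Rightarrow> 'a \<Rightarrow> ennreal" where
  "potential \<mu> u x = (\<Sum>n. averaging (convolution_power \<mu> n) u x)"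

lemma averaging_return_zero [simp]: "averaging (return_pmf 0) u = u"
  by (simp add: averaging_def fun_eq_iff)

lemma averaging_convolution:
  "averaging (convolution_pmf \<nu> \<eta>) u = averaging \<nu> (averaging \<eta> u)"
  by (simp add: averaging_def fun_eq_iff convolution_pmf_def nn_integral_pair_pmf'
      case_prod_beta add.assoc)

lemma averaging_mono: "(\<And>x. u x \<le> v x) \<Longrightarrow> averaging \<nu> u x \<le> averaging \<nu> v x"
  unfolding averaging_def by (intro nn_integral_mono) simp

lemma averaging_cmult: "averaging \<nu> (\<lambda>y. c * u y) x = c * averaging \<nu> u x"
  unfolding averaging_def by (intro nn_integral_cmult) simp

lemma averaging_add: "averaging \<nu> (\<lambda>x. u x + v x) x = averaging \<nu> u x + averaging \<nu> v x"
  unfolding averaging_def by (intro nn_integral_add) auto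

text \<open>
  The definition of the convolution power peels off the last step of the walk; this version
  peels off the first one.
\<close>

lemma averaging_power_Suc:
  "averaging (convolution_power \<mu> (Suc n)) u = averaging \<mu> (averaging (convolution_power \<mu> n) u)"
  by (induction n arbitrary: u) (simp_all add: averaging_convolution)

lemma averaging_ge_term: "ennreal (pmf \<nu> g) * u (x + g) \<le> averaging \<nu> u x"
proof -
  have "ennreal (pmf \<nu> g) * u (x + g)
      = (\<integral>\<^sup>+h. u (x + g) * indicator {g} h \<partial>measure_pmf \<nu>)"
    by (simp add: nn_integral_cmult_indicator emeasure_pmf_single mult.commute)
  also have "\<dots> \<le> averaging \<nu> u x"
    unfolding averaging_def by (intro nn_integral_mono) (auto simp: indicator_def)
  finally show ?thesis .
qed

lemma averaging_eq_sum:
  "averaging \<nu> u x = (\<integral>\<^sup>+z. ennreal (pmf \<nu> (- x + z)) * u z \<partial>count_space UNIV)"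
proof -
  have bij: "bij_betw (\<lambda>g. x + g) UNIV UNIV"
    by (rule bij_betwI[where g = "\<lambda>z. - x + z"]) (auto simp flip: add.assoc)
  have "averaging \<nu> u x = (\<integral>\<^sup>+g. ennreal (pmf \<nu> (- x + (x + g))) * u (x + g) \<partial>count_space UNIV)"
    by (simp add: averaging_def nn_integral_measure_pmf flip: add.assoc)
  also have "\<dots> = (\<integral>\<^sup>+z. ennreal (pmf \<nu> (- x + z)) * u z \<partial>count_space UNIV)"
    by (rule nn_integral_bij_count_space[OF bij])
  finally show ?thesis .
qed

lemma potential_eq_sum_green:
  assumes "transient \<mu>"
  shows "potential \<mu> u x = (\<integral>\<^sup>+z. ennreal (green \<mu> x z) * u z \<partial>count_space UNIV)"
proof -
  have "potential \<mu> u x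
      = (\<Sum>n. \<integral>\<^sup>+z. ennreal (transition_prob \<mu> n x z) * u z \<partial>count_space UNIV)"
    by (simp add: potential_def averaging_eq_sum transition_prob_def)
  also have "\<dots> = (\<integral>\<^sup>+z. (\<Sum>n. ennreal (transition_prob \<mu> n x z) * u z) \<partial>count_space UNIV)"
    by (rule nn_integral_suminf[symmetric]) auto
  also have "\<dots> = (\<integral>\<^sup>+z. ennreal (green \<mu> x z) * u z \<partial>count_space UNIV)"
  proof (rule nn_integral_cong)
    fix z
    have "(\<Sum>n. ennreal (transition_prob \<mu> n x z)) = ennreal (green \<mu> x z)"
      using assms unfolding green_def transient_def
      by (intro suminf_ennreal2) (auto simp: transition_prob_def)
    then show "(\<Sum>n. ennreal (transition_prob \<mu> n x z) * u z) = ennreal (green \<mu> x z) * u z"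
      by simp
  qed
  finally show ?thesis .
qed

lemma potential_indicator:
  assumes "transient \<mu>"
  shows "potential \<mu> (indicator {z}) x = ennreal (green \<mu> x z)"
proof -
  have "potential \<mu> (indicator {z}) x
      = (\<integral>\<^sup>+y. ennreal (green \<mu> x z) * indicator {z} y \<partial>count_space UNIV)"
    unfolding potential_eq_sum_green[OF assms]
    by (intro nn_integral_cong) (auto simp: indicator_def)
  also have "\<dots> = ennreal (green \<mu> x z)"
    by (subst nn_integral_cmult_indicator) auto
  finally show ?thesis .
qed

lemma potential_step: "potential \<mu> u x = u x + averaging \<mu> (potential \<mu> u) x"
proof -
  have "(\<lambda>n. averaging (convolution_power \<mu> (Suc n)) u x) sums averaging \<mu> (potential \<mu> u) x"
  proof -
    have "(\<Sum>n. averaging (convolution_power \<mu> (Suc n)) u x) = averaging \<mu> (potential \<mu> u) x"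
      unfolding averaging_power_Suc potential_def averaging_def [of \<mu>]
      by (rule nn_integral_suminf[symmetric]) auto
    then show ?thesis
      by (metis summableI summable_sums)
  qed
  from sums_Suc[OF this] show ?thesis
    by (simp add: potential_def sums_iff add.commute)
qed

text \<open>Iteration of the Riesz decomposition \<open>u = v + P u\<close>.\<close>

lemma riesz_iterate:
  assumes "\<And>x. u x = v x + averaging \<mu> u x"
  shows "u x = (\<Sum>k<n. averaging (convolution_power \<mu> k) v x)
               + averaging (convolution_power \<mu> n) u x"
proof (induction n)
  case (Suc n)
  have u: "(\<lambda>x. v x + averaging \<mu> u x) = u"
    using assms by (simp add: fun_eq_iff)
  have "averaging (convolution_power \<mu> n) u x
      = averaging (convolution_power \<mu> n) (\<lambda>x. v x + averaging \<mu> u x) x"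
    by (simp only: u)
  also have "\<dots> = averaging (convolution_power \<mu> n) v x
      + averaging (convolution_power \<mu> (Suc n)) u x"
    by (simp add: averaging_add averaging_convolution)
  finally show ?case
    using Suc by (simp add: add.assoc)
qed simp

text \<open>
  Averaging a potential \<open>n\<close> times leaves the tail of its defining series from the \<open>n\<close>-th term
  on.
\<close>

lemma averaging_power_potential_tendsto_0:
  assumes "potential \<mu> w x < \<top>"
  shows "(\<lambda>n. averaging (convolution_power \<mu> n) (potential \<mu> w) x) \<longlonglongrightarrow> 0"
proof -
  let ?S = "\<lambda>n. \<Sum>k<n. averaging (convolution_power \<mu> k) w x"
  have lim: "?S \<longlonglongrightarrow> potential \<mu> w x"
    unfolding potential_def by (intro summable_LIMSEQ summableI)
  have split: "potential \<mu> w x = ?S n + averaging (convolution_power \<mu> n) (potential \<mu> w) x" for n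
    by (rule riesz_iterate[OF potential_step])
  have fin: "?S n < \<top>" for n
    using assms split[of n] by (metis ennreal_add_less_top)
  have "averaging (convolution_power \<mu> n) (potential \<mu> w) x = potential \<mu> w x - ?S n" for n
    using fin[of n] split[of n] by (metis ennreal_add_diff_cancel_left less_top)
  moreover have "(\<lambda>n. potential \<mu> w x - ?S n) \<longlonglongrightarrow> potential \<mu> w x - potential \<mu> w x"
    using assms by (intro tendsto_diff_ennreal tendsto_const lim) auto
  ultimately show ?thesis
    using assms by simp
qed

text \<open>
  In the decomposition \<open>u = \<Sum>\<^bsub>k<n\<^esub> P\<^sup>k v + P\<^sup>n u\<close> the remainder \<open>P\<^sup>n u\<close> vanishes in the limit,
  because the potential above \<open>u\<close> forces it to.
\<close>

lemma dominated_eq_potential: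
  assumes eq: "\<And>x. u x = v x + averaging \<mu> u x"
    and le: "\<And>x. u x \<le> potential \<mu> w x"
    and fin: "potential \<mu> w x < \<top>"
  shows "u x = potential \<mu> v x"
proof -
  have 0: "(\<lambda>n. averaging (convolution_power \<mu> n) u x) \<longlonglongrightarrow> 0"
    by (rule tendsto_sandwich[OF _ _ tendsto_const averaging_power_potential_tendsto_0[OF fin]])
      (auto intro!: always_eventually averaging_mono le)
  have "(\<lambda>n. (\<Sum>k<n. averaging (convolution_power \<mu> k) v x)
      + averaging (convolution_power \<mu> n) u x) \<longlonglongrightarrow> potential \<mu> v x + 0"
    unfolding potential_def by (intro tendsto_add 0 summable_LIMSEQ summableI)
  then show ?thesis
    unfolding riesz_iterate[OF eq, symmetric] by (simp add: LIMSEQ_const_iff)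
qed

section \<open>Harmonic functions as fixed points of the averaging operator\<close>

lemma nn_integral_count_space_infsum:
  fixes f :: "'b \<Rightarrow> real"
  assumes nn: "\<And>x. f x \<ge> 0" and sum: "f summable_on UNIV"
  shows "(\<integral>\<^sup>+x. ennreal (f x) \<partial>count_space UNIV) = ennreal (infsum f UNIV)"
proof -
  have "Infinite_Set_Sum.abs_summable_on f UNIV"
    using abs_summable_equivalent[of f UNIV] sum nn by simp
  then show ?thesis
    using nn by (simp add: nn_integral_conv_infsetsum infsetsum_infsum)
qed

lemma summable_on_if_nn_integral_finite:
  fixes f :: "'b \<Rightarrow> real"
  assumes nn: "\<And>x. f x \<ge> 0" and fin: "(\<integral>\<^sup>+x. ennreal (f x) \<partial>count_space UNIV) < \<infinity>"
  shows "f summable_on UNIV"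
proof -
  have "Infinite_Set_Sum.abs_summable_on f UNIV"
    unfolding Infinite_Set_Sum.abs_summable_on_def
    using fin nn by (intro integrableI_bounded) auto
  then show ?thesis
    using abs_summable_equivalent[of f UNIV] nn by simp
qed

lemma harmonic_iff_averaging:
  assumes f: "\<And>x. f x \<ge> 0"
  shows "harmonic \<mu> f \<longleftrightarrow> (\<forall>x. averaging \<mu> (\<lambda>y. ennreal (f y)) x = ennreal (f x))"
proof -
  have "((\<lambda>g. \<bar>pmf \<mu> g * f (k + g)\<bar>) summable_on UNIV \<and> f k = (\<Sum>\<^sub>\<infinity>g. pmf \<mu> g * f (k + g)))
      \<longleftrightarrow> averaging \<mu> (\<lambda>y. ennreal (f y)) k = ennreal (f k)" for k
  proof -
    let ?h = "\<lambda>g. pmf \<mu> g * f (k + g)"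
    have nn: "?h g \<ge> 0" for g
      using f by simp
    have abs: "(\<lambda>g. \<bar>?h g\<bar>) = ?h"
      using f by (simp add: fun_eq_iff)
    have avg: "averaging \<mu> (\<lambda>y. ennreal (f y)) k = (\<integral>\<^sup>+g. ennreal (?h g) \<partial>count_space UNIV)"
      using f by (simp add: averaging_def nn_integral_measure_pmf ennreal_mult)
    have int: "averaging \<mu> (\<lambda>y. ennreal (f y)) k = ennreal (infsum ?h UNIV)"
      if "?h summable_on UNIV"
      unfolding avg by (rule nn_integral_count_space_infsum[OF nn that])
    have fin: "?h summable_on UNIV"
      if "averaging \<mu> (\<lambda>y. ennreal (f y)) k = ennreal (f k)"
      using that unfolding avg by (intro summable_on_if_nn_integral_finite nn) simp
    show ?thesis
      unfolding abs using int fin f[of k] infsum_nonneg[of UNIV ?h, OF nn] by auto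
  qed
  then show ?thesis
    by (simp add: harmonic_def)
qed

section \<open>Boundaries of exhaustions\<close>

lemma exists_word:
  assumes "finite_symmetric_generating T"
  shows "\<exists>ws. set ws \<subseteq> T \<and> sum_list ws = g"
proof -
  have inv: "- sum_list ws = sum_list (rev (map uminus ws))" for ws :: "'a list"
    by (induction ws) (simp_all add: minus_add)
  have "g \<in> subgroup_gen T"
    using assms by (simp add: finite_symmetric_generating_def)
  then show ?thesis
  proof induction
    case zero
    show ?case by (rule exI[of _ "[]"]) simp
  next
    case (incl x)
    then show ?case by (intro exI[of _ "[x]"]) simp
  next
    case (minus x)
    then obtain ws where "set ws \<subseteq> T" "sum_list ws = x" by blast
    then show ?case
      using assms inv[of ws]
      by (intro exI[of _ "rev (map uminus ws)"]) (auto simp: finite_symmetric_generating_def)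
  next
    case (plus x y)
    then obtain vs ws where "set vs \<subseteq> T" "sum_list vs = x" "set ws \<subseteq> T" "sum_list ws = y"
      by blast
    then show ?case by (intro exI[of _ "vs @ ws"]) simp
  qed
qed

lemma countable_if_finitely_generated:
  assumes "finite_symmetric_generating (T :: 'a::group_add set)"
  shows "countable (UNIV :: 'a set)"
proof -
  have "UNIV \<subseteq> sum_list ` lists T"
    using exists_word[OF assms] by (auto simp: image_iff lists_eq_set) metis
  moreover have "countable (lists T)"
    using assms by (intro countable_lists countable_finite)
      (simp add: finite_symmetric_generating_def)
  ultimately show ?thesis
    by (meson countable_image countable_subset)
qed

lemma finite_outer_boundary:
  assumes "finite T" "finite S"
  shows "finite (outer_boundary T S)"
proof (rule finite_subset)
  show "outer_boundary T S \<subseteq> (\<lambda>(y, t). y + t) ` (S \<times> T)"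
    by (force simp: outer_boundary_def)
  show "finite ((\<lambda>(y, t). y + t) ` (S \<times> T))"
    using assms by simp
qed

text \<open>
  A set without boundary is closed under right multiplication by the generators, hence
  contains every word that starts in it, which is everything.
\<close>

lemma outer_boundary_nonempty:
  assumes "infinite (UNIV :: 'a::group_add set)" and T: "finite_symmetric_generating (T :: 'a set)"
    and S: "finite S" "S \<noteq> {}"
  shows "outer_boundary T S \<noteq> {}"
proof
  assume empty: "outer_boundary T S = {}"
  obtain x where x: "x \<in> S" using S by blast
  have closed: "y + sum_list ws \<in> S" if "set ws \<subseteq> T" "y \<in> S" for ws y
    using that
  proof (induction ws arbitrary: y)
    case (Cons t ws)
    then have "y + t \<in> S"
      using empty by (auto simp: outer_boundary_def)
    then show ?case
      using Cons by (simp flip: add.assoc)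
  qed simp
  have "g \<in> S" for g
  proof -
    obtain ws where "set ws \<subseteq> T" "sum_list ws = - x + g"
      using exists_word[OF T] by blast
    with closed[OF this(1) x] show ?thesis by (simp flip: add.assoc)
  qed
  then have "S = UNIV" by blast
  with assms(1) S show False by simp
qed

lemma exhaustion_eventually_contains:
  assumes "exhaustion F" "finite K"
  shows "eventually (\<lambda>n. K \<subseteq> F n) sequentially"
proof -
  have "eventually (\<lambda>n. x \<in> F n) sequentially" for x
  proof -
    have "x \<in> (\<Union>n. F n)"
      using assms(1) by (simp add: exhaustion_def)
    then obtain n where "x \<in> F n"
      by blast
    then show ?thesis
      using assms(1) unfolding exhaustion_def incseq_def eventually_sequentially by blast
  qed
  then have "eventually (\<lambda>n. \<forall>x\<in>K. x \<in> F n) sequentially"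
    using assms(2) by (simp add: eventually_ball_finite_distrib)
  then show ?thesis
    by (simp add: subset_eq)
qed

text \<open>
  At each stage an unused point \<open>x\<close> of \<open>B\<close> exists, as the set built so far is
  finite. Adding its neighbour \<open>x + - t\<close>, but not \<open>x\<close> itself, puts \<open>x\<close> on the boundary.
  At later stages \<open>x\<close> may be swallowed, so that the sets can still exhaust the group.
\<close>

lemma exists_exhaustion_with_boundary_in:
  assumes inf: "infinite (UNIV :: 'a::group_add set)"
    and T: "finite_symmetric_generating (T :: 'a set)" and B: "infinite B"
  shows "\<exists>F. exhaustion F \<and> (\<forall>n. \<exists>x\<in>B. x \<in> outer_boundary T (F n))"
proof -
  have count: "countable (UNIV :: 'a set)"
    by (rule countable_if_finitely_generated[OF T])
  obtain t where t: "t \<in> T" "t \<noteq> 0"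
  proof (rule ccontr)
    assume "\<not> thesis"
    then have "\<forall>t\<in>T. t = 0" using that by blast
    then have "sum_list ws = 0" if "set ws \<subseteq> T" for ws
      using that by (induction ws) auto
    then have "g = 0" for g :: 'a
      using exists_word[OF T, of g] by blast
    then have "(UNIV :: 'a set) \<subseteq> {0}"
      by blast
    with inf show False
      using finite_subset by blast
  qed
  define E where "E n = from_nat_into (UNIV :: 'a set) ` {..n}" for n :: nat
  have E: "finite (E n)" for n
    by (simp add: E_def)
  have step: "\<exists>S'. (finite S' \<and> E n \<subseteq> S' \<and> (\<exists>x\<in>B. x \<in> outer_boundary T S')) \<and> S \<subseteq> S'"
    if "finite S" for S n
  proof -
    have "infinite (B - (S \<union> E n))"
      using B that E by (simp add: Diff_infinite_finite)
    then have "B - (S \<union> E n) \<noteq> {}"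
      by (rule infinite_imp_nonempty)
    then obtain x where x: "x \<in> B" "x \<notin> S" "x \<notin> E n"
      by blast
    have "x \<noteq> x + - t"
    proof
      assume "x = x + - t"
      then have "x + 0 = x + - t"
        by simp
      then have "0 = - t"
        by (rule add_left_imp_eq)
      with t show False by simp
    qed
    moreover have "x = (x + - t) + t"
      by (simp add: add.assoc)
    ultimately have "x \<in> outer_boundary T (insert (x + - t) (S \<union> E n))"
      using t x unfolding outer_boundary_def by blast
    with x that E show ?thesis
      by (intro exI[of _ "insert (x + - t) (S \<union> E n)"]) auto
  qed
  have "\<exists>F. \<forall>n. (finite (F n) \<and> E n \<subseteq> F n \<and> (\<exists>x\<in>B. x \<in> outer_boundary T (F n)))
      \<and> F n \<subseteq> F (Suc n)"
  proof (rule dependent_nat_choice)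
    show "\<exists>S. finite S \<and> E 0 \<subseteq> S \<and> (\<exists>x\<in>B. x \<in> outer_boundary T S)"
      using step[OF finite.emptyI, of 0] by blast
  qed (use step in blast)
  then obtain F where F: "\<And>n. finite (F n) \<and> E n \<subseteq> F n \<and> (\<exists>x\<in>B. x \<in> outer_boundary T (F n))"
      "\<And>n. F n \<subseteq> F (Suc n)"
    by blast
  have "x \<in> (\<Union>n. F n)" for x
  proof -
    have "x \<in> E (to_nat_on UNIV x)"
      unfolding E_def using from_nat_into_to_nat_on[OF count UNIV_I[of x]]
      by (metis atMost_iff imageI order_refl)
    then show ?thesis using F(1) by blast
  qed
  moreover have "F n \<noteq> {}" for n
    using F(1)[of n] by (auto simp: outer_boundary_def)
  moreover have "incseq F"
    using F(2) by (rule incseq_SucI)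
  ultimately have "exhaustion F"
    using F(1) by (auto simp: exhaustion_def)
  with F show ?thesis by blast
qed

text \<open>
  The boundary of \<open>F n\<close> avoids any given finite set once \<open>F n\<close> contains that set. Conversely, if
  \<open>\<phi>\<close> is at least \<open>e\<close> at infinitely many points, some exhaustion has one of them on each boundary.
\<close>

lemma boundary_maximum_tendsto_iff:
  fixes \<phi> :: "'a::group_add \<Rightarrow> real"
  assumes inf: "infinite (UNIV :: 'a set)" and T: "finite_symmetric_generating T"
    and nn: "\<And>x. \<phi> x \<ge> 0"
  shows "(\<forall>F. exhaustion F \<longrightarrow> (\<lambda>n. Max (\<phi> ` outer_boundary T (F n))) \<longlonglongrightarrow> 0)
     \<longleftrightarrow> (\<phi> \<longlongrightarrow> 0) cofinite"
proof
  have fin: "finite (outer_boundary T (F n))" if "exhaustion F" for F n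
    using that T by (auto simp: exhaustion_def finite_symmetric_generating_def
        intro: finite_outer_boundary)
  have ne: "outer_boundary T (F n) \<noteq> {}" if "exhaustion F" for F n
    using that by (intro outer_boundary_nonempty inf T) (auto simp: exhaustion_def)
  {
    assume *: "\<forall>F. exhaustion F \<longrightarrow> (\<lambda>n. Max (\<phi> ` outer_boundary T (F n))) \<longlonglongrightarrow> 0"
    show "(\<phi> \<longlongrightarrow> 0) cofinite"
    proof (rule tendstoI, rule ccontr)
      fix e :: real
      assume "e > 0" and "\<not> (\<forall>\<^sub>F x in cofinite. dist (\<phi> x) 0 < e)"
      then have "infinite {x. \<phi> x \<ge> e}"
        using nn by (simp add: eventually_cofinite not_less)
      from exists_exhaustion_with_boundary_in[OF inf T this]
      obtain F where F: "exhaustion F" "\<And>n. \<exists>x. \<phi> x \<ge> e \<and> x \<in> outer_boundary T (F n)"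
        by auto
      have le: "e \<le> Max (\<phi> ` outer_boundary T (F n))" for n
        using F(2)[of n] fin[OF F(1), of n] by (meson Max_ge finite_imageI imageI order_trans)
      have "(\<lambda>n. Max (\<phi> ` outer_boundary T (F n))) \<longlonglongrightarrow> 0"
        using * F(1) by blast
      then have "e \<le> 0"
        by (rule LIMSEQ_le_const) (use le in blast)
      with \<open>e > 0\<close> show False by simp
    qed
  next
    assume *: "(\<phi> \<longlongrightarrow> 0) cofinite"
    show "\<forall>F. exhaustion F \<longrightarrow> (\<lambda>n. Max (\<phi> ` outer_boundary T (F n))) \<longlonglongrightarrow> 0"
    proof (intro allI impI tendstoI)
      fix F :: "nat \<Rightarrow> 'a set" and e :: real
      assume F: "exhaustion F" and "e > 0"
      then have "finite {x. \<phi> x \<ge> e}"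
        using tendstoD[OF *, of e] nn by (simp add: eventually_cofinite not_less)
      from exhaustion_eventually_contains[OF F this]
      show "\<forall>\<^sub>F n in sequentially. dist (Max (\<phi> ` outer_boundary T (F n))) 0 < e"
      proof eventually_elim
        case (elim n)
        have "Max (\<phi> ` outer_boundary T (F n)) \<in> \<phi> ` outer_boundary T (F n)"
          using fin[OF F] ne[OF F] by (intro Max_in) auto
        then obtain x where "x \<in> outer_boundary T (F n)"
            "Max (\<phi> ` outer_boundary T (F n)) = \<phi> x"
          by blast
        moreover from this(1) elim have "\<phi> x < e"
          by (force simp: outer_boundary_def)
        ultimately show ?case
          using nn by simp
      qed
    qed
  }
qed

section \<open>The Green function\<close>

lemma set_convolution_power_add:
  assumes "x \<in> set_pmf (convolution_power \<mu> m)" "y \<in> set_pmf (convolution_power \<mu> n)"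
  shows "x + y \<in> set_pmf (convolution_power \<mu> (m + n))"
  using assms(2)
proof (induction n arbitrary: y)
  case (Suc n)
  then obtain z g where "y = z + g" "z \<in> set_pmf (convolution_power \<mu> n)" "g \<in> set_pmf \<mu>"
    by (auto simp: convolution_pmf_def)
  with Suc.IH[of z] show ?case
    by (force simp: convolution_pmf_def simp flip: add.assoc)
qed (use assms(1) in simp)

lemma green_pos:
  assumes nondeg: "nondegenerate \<mu>" and trans: "transient \<mu>"
  shows "green \<mu> x y > 0"
proof -
  have "- x + y \<in> semigroup_gen (set_pmf \<mu>)"
    using nondeg by (simp add: nondegenerate_def)
  then have "\<exists>n. - x + y \<in> set_pmf (convolution_power \<mu> n)"
  proof induction
    case (incl g)
    then have "g \<in> set_pmf (convolution_power \<mu> (Suc 0))"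
      by (force simp: convolution_pmf_def)
    then show ?case by blast
  next
    case (plus g h)
    then show ?case using set_convolution_power_add by blast
  qed
  then obtain n where "- x + y \<in> set_pmf (convolution_power \<mu> n)" ..
  then have "transition_prob \<mu> n x y > 0"
    unfolding transition_prob_def by (rule pmf_positive)
  then show ?thesis
    using trans unfolding green_def transient_def
    by (intro suminf_pos2[where i = n]) (auto simp: transition_prob_def)
qed

text \<open>The Green function is harmonic in its first variable, except at the pole.\<close>

lemma green_step:
  assumes "transient \<mu>"
  shows "ennreal (green \<mu> y x) = indicator {x} y + averaging \<mu> (\<lambda>y. ennreal (green \<mu> y x)) y"
proof -
  have "potential \<mu> (indicator {x}) = (\<lambda>y. ennreal (green \<mu> y x))"
    by (simp add: fun_eq_iff potential_indicator[OF assms])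
  with potential_step[of \<mu> "indicator {x}" y] show ?thesis
    by simp
qed

lemma green_step_le:
  assumes "transient \<mu>"
  shows "pmf \<mu> s * green \<mu> (y + s) x \<le> green \<mu> y x"
proof -
  have nn: "green \<mu> z x \<ge> 0" for z
    using assms unfolding green_def transient_def
    by (intro suminf_nonneg) (auto simp: transition_prob_def)
  have "ennreal (pmf \<mu> s * green \<mu> (y + s) x) = ennreal (pmf \<mu> s) * ennreal (green \<mu> (y + s) x)"
    using nn by (simp add: ennreal_mult)
  also have "\<dots> \<le> averaging \<mu> (\<lambda>y. ennreal (green \<mu> y x)) y"
    by (rule averaging_ge_term)
  also have "\<dots> \<le> ennreal (green \<mu> y x)"
    unfolding green_step[OF assms, of y x] by simp
  finally show ?thesis
    using nn by simp
qed

lemma green_harnack_word: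
  assumes trans: "transient \<mu>" and \<rho>: "\<rho> > 0" "\<And>s. s \<in> set ws \<Longrightarrow> \<rho> \<le> pmf \<mu> s"
    and nn: "\<And>y. green \<mu> y x \<ge> 0"
  shows "\<rho> ^ length ws * green \<mu> (y + sum_list ws) x \<le> green \<mu> y x"
  using \<rho>(2)
proof (induction ws arbitrary: y)
  case (Cons s ws)
  have "\<rho> ^ length (s # ws) * green \<mu> (y + sum_list (s # ws)) x
      = \<rho> * (\<rho> ^ length ws * green \<mu> ((y + s) + sum_list ws) x)"
    by (simp add: add.assoc)
  also have "\<dots> \<le> \<rho> * green \<mu> (y + s) x"
    using Cons \<rho>(1) by (intro mult_left_mono) auto
  also have "\<dots> \<le> pmf \<mu> s * green \<mu> (y + s) x"
    using Cons.prems nn by (intro mult_right_mono) auto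
  also have "\<dots> \<le> green \<mu> y x"
    by (rule green_step_le[OF trans])
  finally show ?case .
qed simp

text \<open>
  Harnack inequality: following a shortest word for \<open>g\<close>, the walk gets from \<open>y\<close> to
  \<open>y + g\<close> with probability at least \<open>\<rho>\<close> to the power \<open>|g|\<close>.
\<close>

lemma green_harnack:
  assumes trans: "transient \<mu>" and S: "finite_symmetric_generating S"
    and \<rho>: "\<rho> > 0" "\<And>s. s \<in> S \<Longrightarrow> \<rho> \<le> pmf \<mu> s"
    and nn: "\<And>y. green \<mu> y x \<ge> 0"
  shows "\<rho> ^ word_length S g * green \<mu> (y + g) x \<le> green \<mu> y x"
proof -
  have "\<exists>n ws. length ws = n \<and> set ws \<subseteq> S \<and> sum_list ws = g"
    using exists_word[OF S] by blast
  then have "\<exists>ws. length ws = word_length S g \<and> set ws \<subseteq> S \<and> sum_list ws = g"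
    unfolding word_length_def by (rule LeastI_ex)
  then obtain ws where ws: "length ws = word_length S g" "set ws \<subseteq> S" "sum_list ws = g"
    by blast
  then show ?thesis
    using green_harnack_word[OF trans \<rho>(1) _ nn, of ws y] \<rho>(2) by auto
qed

section \<open>From the strong Liouville property to asymptotically equal Green functions\<close>

text \<open>
  Compactness and dominated convergence; the limits are Martin kernels of boundary points. The Harnack inequality bounds the quotients from above and, applied in the opposite
  direction, keeps their limits positive.
\<close>

lemma green_ratio_subsequence_harmonic_limit:
  fixes \<mu> :: "'a::group_add pmf" and X :: "nat \<Rightarrow> 'a"
  assumes trans: "transient \<mu>" and pos: "\<And>x y. green \<mu> x y > 0"
    and moment: "exp_moment_condition \<mu>" and X: "inj X"
  shows "\<exists>r L. strict_mono r
    \<and> (\<forall>y. (\<lambda>n. green \<mu> y (X (r n)) / green \<mu> 0 (X (r n))) \<longlonglongrightarrow> L y)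
    \<and> (\<forall>y. L y > 0) \<and> harmonic \<mu> L"
proof -
  obtain S \<rho> where S: "finite_symmetric_generating S" and \<rho>: "\<rho> > 0" "\<rho> < Min (pmf \<mu> ` S)"
    and sum: "(\<lambda>g. pmf \<mu> g * \<rho> powi (- int (word_length S g))) summable_on UNIV"
    using moment by (auto simp: exp_moment_condition_def)
  let ?l = "word_length S"
  have \<rho>_le: "\<rho> \<le> pmf \<mu> s" if "s \<in> S" for s
  proof -
    have "Min (pmf \<mu> ` S) \<le> pmf \<mu> s"
      using that S by (simp add: finite_symmetric_generating_def)
    with \<rho>(2) show ?thesis by simp
  qed
  note harnack = green_harnack[OF trans S \<rho>(1) \<rho>_le less_imp_le[OF pos]]
  define K where "K n y = green \<mu> y (X n) / green \<mu> 0 (X n)" for n y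
  have K_pos: "K n y > 0" for n y
    by (simp add: K_def pos)
  have K_harnack: "\<rho> ^ ?l g * K n (y + g) \<le> K n y" for n y g
    using harnack[of g y "X n"] pos[of 0 "X n"] by (simp add: K_def divide_right_mono)
  have K_0: "K n 0 = 1" for n
    using pos[of 0 "X n"] by (simp add: K_def)
  have K_upper: "\<rho> ^ ?l y * K n y \<le> 1" for n y
    using K_harnack[of y n 0] K_0 by simp
  have K_lower: "\<rho> ^ ?l (- y) \<le> K n y" for n y
    using K_harnack[of "- y" n y] K_0[of n] by simp
  have bounded: "norm (\<rho> ^ ?l y * K n y) \<le> 1" for n y
    using K_upper[of y n] K_pos[of n y] \<rho>(1) by simp
  (* The common bound 1 for all points is what the compactness argument asks for. *)
  obtain r :: "nat \<Rightarrow> nat" where r: "strict_mono r"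
    and conv: "\<And>y. \<exists>l. (\<lambda>n. \<rho> ^ ?l y * K (r n) y) \<longlonglongrightarrow> l"
  proof (rule function_convergent_subsequence[OF countable_if_finitely_generated[OF S] bounded])
    fix k :: "nat \<Rightarrow> nat"
    assume "strict_mono k"
      and "\<And>y. y \<in> UNIV \<Longrightarrow> \<exists>l. (\<lambda>n. \<rho> ^ ?l y * K (k n) y) \<longlonglongrightarrow> l"
    then show thesis
      by (intro that[of k]) auto
  qed
  have "\<exists>l. (\<lambda>n. K (r n) y) \<longlonglongrightarrow> l" for y
  proof -
    obtain l where "(\<lambda>n. \<rho> ^ ?l y * K (r n) y) \<longlonglongrightarrow> l"
      using conv by blast
    from tendsto_divide[OF this tendsto_const[of "\<rho> ^ ?l y"]] \<rho>(1) show ?thesis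
      by auto
  qed
  then obtain L where L: "\<And>y. (\<lambda>n. K (r n) y) \<longlonglongrightarrow> L y"
    by metis
  have L_pos: "L y > 0" for y
  proof -
    have "\<rho> ^ ?l (- y) \<le> L y"
      by (rule LIMSEQ_le_const[OF L]) (use K_lower in blast)
    moreover have "\<rho> ^ ?l (- y) > 0"
      using \<rho>(1) by simp
    ultimately show ?thesis by linarith
  qed
  have K_avg: "averaging \<mu> (\<lambda>y. ennreal (K n y)) y = ennreal (K n y)" if "X n \<noteq> y" for n y
  proof -
    let ?c = "ennreal (1 / green \<mu> 0 (X n))"
    have K: "ennreal (K n z) = ?c * ennreal (green \<mu> z (X n))" for z
      using pos[of 0 "X n"] pos[of z "X n"] by (simp add: K_def flip: ennreal_mult)
    show ?thesis
      unfolding K averaging_cmult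
      using green_step[OF trans, of y "X n"] that by (simp add: indicator_def)
  qed
  have "averaging \<mu> (\<lambda>y. ennreal (L y)) y = ennreal (L y)" for y
  proof (rule LIMSEQ_unique)
    let ?w = "\<lambda>g. ennreal (1 / \<rho> ^ ?l y) * ennreal (\<rho> powi (- int (?l g)))"
    have bound: "ennreal (K n (y + g)) \<le> ?w g" for n g
    proof -
      have "K n (y + g) \<le> K n y / \<rho> ^ ?l g"
        using K_harnack[of g n y] \<rho>(1) by (simp add: field_simps)
      also have "\<dots> \<le> (1 / \<rho> ^ ?l y) / \<rho> ^ ?l g"
        using K_upper[of y n] \<rho>(1) by (intro divide_right_mono) (auto simp: field_simps)
      finally show ?thesis
        using \<rho>(1) by (simp add: power_int_minus divide_inverse flip: ennreal_mult)
    qed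
    have "(\<integral>\<^sup>+g. ennreal (\<rho> powi (- int (?l g))) \<partial>measure_pmf \<mu>)
        = ennreal (\<Sum>\<^sub>\<infinity>g. pmf \<mu> g * \<rho> powi (- int (?l g)))"
      using nn_integral_count_space_infsum[OF _ sum] \<rho>(1)
      by (simp add: nn_integral_measure_pmf ennreal_mult)
    then have fin: "(\<integral>\<^sup>+g. ?w g \<partial>measure_pmf \<mu>) < \<infinity>"
      by (subst nn_integral_cmult) (auto simp: ennreal_mult_less_top)
    show "(\<lambda>n. averaging \<mu> (\<lambda>y. ennreal (K (r n) y)) y) \<longlonglongrightarrow> averaging \<mu> (\<lambda>y. ennreal (L y)) y"
      unfolding averaging_def
      by (rule nn_integral_dominated_convergence[where w = ?w])
        (use bound fin L in auto)
    have "finite {n. X (r n) = y}"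
    proof -
      have "inj (\<lambda>n. X (r n))"
        using inj_compose[OF X strict_mono_imp_inj_on[OF r]] by (simp add: comp_def)
      from finite_vimageI[OF _ this, of "{y}"] show ?thesis
        by (simp add: vimage_def)
    qed
    then have "\<forall>\<^sub>F n in sequentially. X (r n) \<noteq> y"
      by (simp flip: cofinite_eq_sequentially add: eventually_cofinite)
    then have "\<forall>\<^sub>F n in sequentially. ennreal (K (r n) y) = averaging \<mu> (\<lambda>y. ennreal (K (r n) y)) y"
      by eventually_elim (simp add: K_avg)
    then show "(\<lambda>n. averaging \<mu> (\<lambda>y. ennreal (K (r n) y)) y) \<longlonglongrightarrow> ennreal (L y)"
      by (rule Lim_transform_eventually[OF tendsto_ennrealI[OF L]])
  qed
  then have "harmonic \<mu> L"
    using harmonic_iff_averaging[of L \<mu>] less_imp_le[OF L_pos] by simp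
  with r L L_pos show ?thesis
    unfolding K_def by (intro exI[of _ r] exI[of _ L]) simp
qed

text \<open>
  A sequence of distinct points at which the relative difference is at least \<open>e\<close> would have a
  subsequence along which \<open>G(y,x) / G(0,x)\<close> converges to a positive harmonic function of \<open>y\<close>.
  This limit is constant, so along the subsequence the relative difference tends to \<open>0\<close>.
\<close>

lemma green_ratio_tendsto_if_strong_liouville:
  fixes \<mu> :: "'a::group_add pmf"
  assumes trans: "transient \<mu>" and pos: "\<And>x y. green \<mu> x y > 0"
    and moment: "exp_moment_condition \<mu>" and liouville: "strong_liouville \<mu>"
  shows "((\<lambda>x. \<bar>green \<mu> a x - green \<mu> b x\<bar> / green \<mu> a x) \<longlongrightarrow> 0) cofinite"
proof (rule tendstoI, rule ccontr)
  fix e :: real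
  assume e: "e > 0"
  let ?\<phi> = "\<lambda>x. \<bar>green \<mu> a x - green \<mu> b x\<bar> / green \<mu> a x"
  assume "\<not> (\<forall>\<^sub>F x in cofinite. dist (?\<phi> x) 0 < e)"
  then have "infinite {x. e \<le> ?\<phi> x}"
    using less_imp_le[OF pos] by (simp add: eventually_cofinite not_less)
  then obtain X :: "nat \<Rightarrow> 'a" where X: "inj X" "\<And>n. e \<le> ?\<phi> (X n)"
    using infinite_countable_subset[of "{x. e \<le> ?\<phi> x}"] by blast
  obtain r L where "strict_mono r"
    and L: "\<And>y. (\<lambda>n. green \<mu> y (X (r n)) / green \<mu> 0 (X (r n))) \<longlonglongrightarrow> L y"
    and L_pos: "\<And>y. L y > 0" and "harmonic \<mu> L"
    using green_ratio_subsequence_harmonic_limit[OF trans pos moment X(1)] by blast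
  then obtain c where "\<And>y. L y = c"
    using liouville L_pos unfolding strong_liouville_def by blast
  moreover have "L 0 = 1"
    using LIMSEQ_unique[OF L[of 0]] less_imp_neq[OF pos] by simp
  ultimately have L_1: "L y = 1" for y
    by metis
  define K where "K n y = green \<mu> y (X (r n)) / green \<mu> 0 (X (r n))" for n y
  have "(\<lambda>n. \<bar>K n a - K n b\<bar> / K n a) \<longlonglongrightarrow> \<bar>L a - L b\<bar> / L a"
    using L_pos[of a] unfolding K_def by (intro tendsto_intros L) simp
  moreover have "\<bar>K n a - K n b\<bar> / K n a = ?\<phi> (X (r n))" for n
    using pos[of 0 "X (r n)"] pos[of a "X (r n)"]
    by (simp add: K_def flip: diff_divide_distrib)
  ultimately have "(\<lambda>n. ?\<phi> (X (r n))) \<longlonglongrightarrow> 0"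
    by (simp add: L_1)
  then have "e \<le> 0"
    by (rule LIMSEQ_le_const) (use X(2) in blast)
  with e show False by simp
qed

section \<open>From asymptotically equal Green functions to the strong Liouville property\<close>

text \<open>
  The harmonic \<open>f\<close> is cut off by potentials of larger and larger finite charges. The
  minimum \<open>u\<^sub>n\<close> of two superharmonic functions is superharmonic and lies below a finite
  potential, so it is the potential of its charge \<open>v\<^sub>n = u\<^sub>n - P u\<^sub>n\<close>. As \<open>u\<^sub>n\<close> tends to \<open>f\<close>, the
  charge \<open>v\<^sub>n\<close> tends to \<open>f - P f = 0\<close>.
\<close>

lemma harmonic_limit_of_potentials:
  fixes \<mu> :: "'a::group_add pmf"
  assumes count: "countable (UNIV :: 'a set)" and trans: "transient \<mu>"
    and harm: "harmonic \<mu> f" and f: "\<And>x. f x > 0"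
  shows "\<exists>v. (\<forall>z. (\<lambda>n. v n z) \<longlonglongrightarrow> 0)
    \<and> (\<forall>x. (\<lambda>n. potential \<mu> (v n) x) \<longlonglongrightarrow> ennreal (f x))"
proof -
  have f_avg: "averaging \<mu> (\<lambda>y. ennreal (f y)) x = ennreal (f x)" for x
    using harm harmonic_iff_averaging[of f \<mu>] less_imp_le[OF f] by simp
  (* The cut-off is at the potential of n times the indicator of B n; it exceeds f z as soon as
     B n contains z and n is at least f z, so that u n z is eventually f z. *)
  define B where "B n = from_nat_into (UNIV :: 'a set) ` {..n}" for n :: nat
  have B: "finite (B n)" for n
    by (simp add: B_def)
  define w :: "nat \<Rightarrow> 'a \<Rightarrow> ennreal" where "w n z = of_nat n * indicator (B n) z" for n z
  define u where "u n x = min (ennreal (f x)) (potential \<mu> (w n) x)" for n x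
  define v where "v n x = u n x - averaging \<mu> (u n) x" for n x
  have w_fin: "potential \<mu> (w n) x < \<top>" for n x
  proof -
    have "potential \<mu> (w n) x
        = (\<integral>\<^sup>+z. (ennreal (green \<mu> x z) * of_nat n) * indicator (B n) z \<partial>count_space UNIV)"
      unfolding potential_eq_sum_green[OF trans] w_def by (simp add: mult.assoc)
    also have "\<dots> = (\<Sum>z\<in>B n. ennreal (green \<mu> x z) * of_nat n)"
      using B by (subst nn_integral_indicator_finite) auto
    also have "\<dots> < \<top>"
      using B[of n] by (simp add: ennreal_mult_less_top of_nat_less_top)
    finally show ?thesis .
  qed
  have u_super: "averaging \<mu> (u n) x \<le> u n x" for n x
  proof -
    have "averaging \<mu> (u n) x \<le> averaging \<mu> (\<lambda>y. ennreal (f y)) x"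
      by (rule averaging_mono) (simp add: u_def)
    moreover have "averaging \<mu> (u n) x \<le> averaging \<mu> (potential \<mu> (w n)) x"
      by (rule averaging_mono) (simp add: u_def)
    moreover have "averaging \<mu> (potential \<mu> (w n)) x \<le> potential \<mu> (w n) x"
      unfolding potential_step[of \<mu> "w n" x] by simp
    ultimately show ?thesis
      unfolding u_def[of n x] f_avg by (auto intro: order_trans)
  qed
  have u_eq: "u n x = v n x + averaging \<mu> (u n) x" for n x
    unfolding v_def by (simp add: diff_add_cancel_ennreal u_super)
  have u_pot: "u n x = potential \<mu> (v n) x" for n x
    by (rule dominated_eq_potential[where w = "w n", OF u_eq _ w_fin]) (simp add: u_def)
  have u_lim: "(\<lambda>n. u n z) \<longlonglongrightarrow> ennreal (f z)" for z
  proof (rule tendsto_eventually)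
    have "u n z = ennreal (f z)" if n: "n \<ge> to_nat_on UNIV z" "n \<ge> nat \<lceil>f z\<rceil>" for n
    proof -
      have "z \<in> B n"
        unfolding B_def using from_nat_into_to_nat_on[OF count UNIV_I[of z]] n(1)
        by (metis atMost_iff imageI)
      have "ennreal (f z) \<le> of_nat n"
        using n(2) by (simp add: ennreal_of_nat_eq_real_of_nat)
      also have "\<dots> = w n z"
        using \<open>z \<in> B n\<close> by (simp add: w_def)
      also have "\<dots> \<le> potential \<mu> (w n) z"
        unfolding potential_step[of \<mu> "w n" z] by simp
      finally show ?thesis
        by (simp add: u_def min_absorb1)
    qed
    then show "\<forall>\<^sub>F n in sequentially. u n z = ennreal (f z)"
      by (intro eventually_sequentiallyI[of "max (to_nat_on UNIV z) (nat \<lceil>f z\<rceil>)"]) auto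
  qed
  (* The charge of f itself is f - P f = 0. *)
  have v_lim: "(\<lambda>n. v n z) \<longlonglongrightarrow> 0" for z
  proof -
    have "(\<lambda>n. averaging \<mu> (u n) z) \<longlonglongrightarrow> averaging \<mu> (\<lambda>y. ennreal (f y)) z"
      unfolding averaging_def
    proof (rule nn_integral_dominated_convergence[where w = "\<lambda>g. ennreal (f (z + g))"])
      show "(\<integral>\<^sup>+g. ennreal (f (z + g)) \<partial>measure_pmf \<mu>) < \<infinity>"
        using f_avg[of z] by (simp add: averaging_def)
      show "AE g in measure_pmf \<mu>. u n (z + g) \<le> ennreal (f (z + g))" for n
        by (simp add: u_def)
    qed (simp_all add: u_lim)
    then have "(\<lambda>n. u n z - averaging \<mu> (u n) z) \<longlonglongrightarrow> ennreal (f z) - ennreal (f z)"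
      unfolding f_avg by (intro tendsto_diff_ennreal u_lim) auto
    then show ?thesis
      by (simp add: v_def)
  qed
  show ?thesis
    using v_lim u_lim unfolding u_pot by (intro exI[of _ v]) simp
qed

text \<open>
  Potentials at \<open>a\<close> and at \<open>b\<close> are compared term by term. The comparison fails at finitely many
  points only, where the charges of the approximating potentials vanish in the limit.
\<close>

lemma strong_liouville_if_green_ratio_tendsto:
  fixes \<mu> :: "'a::group_add pmf"
  assumes count: "countable (UNIV :: 'a set)" and trans: "transient \<mu>"
    and pos: "\<And>x y. green \<mu> x y > 0"
    and lim: "\<And>a b. ((\<lambda>x. \<bar>green \<mu> a x - green \<mu> b x\<bar> / green \<mu> a x) \<longlongrightarrow> 0) cofinite"
  shows "strong_liouville \<mu>"
proof -
  have "f b \<le> f a" if harm: "harmonic \<mu> f" and f: "\<And>x. f x > 0" for f a b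
  proof -
    obtain v where v_lim: "\<And>z. (\<lambda>n. v n z) \<longlonglongrightarrow> (0 :: ennreal)"
      and pot_lim: "\<And>x. (\<lambda>n. potential \<mu> (v n) x) \<longlonglongrightarrow> ennreal (f x)"
      using harmonic_limit_of_potentials[OF count trans harm f] by blast
    define u where "u n x = potential \<mu> (v n) x" for n x
    have u_lim: "(\<lambda>n. u n x) \<longlonglongrightarrow> ennreal (f x)" for x
      unfolding u_def by (rule pot_lim)
    have approx: "f b \<le> c * f a" if c: "c > 1" for c
    proof -
      define C where "C = {z. \<not> green \<mu> b z \<le> c * green \<mu> a z}"
      have "\<forall>\<^sub>F z in cofinite. green \<mu> b z \<le> c * green \<mu> a z"
      proof -
        have "\<forall>\<^sub>F z in cofinite.
            dist (\<bar>green \<mu> a z - green \<mu> b z\<bar> / green \<mu> a z) 0 < c - 1"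
          using c by (intro tendstoD[OF lim]) simp
        then show ?thesis
        proof eventually_elim
          case (elim z)
          then have "\<bar>green \<mu> a z - green \<mu> b z\<bar> < (c - 1) * green \<mu> a z"
            using pos[of a z] by (simp add: field_simps)
          then show ?case
            by (simp add: algebra_simps)
        qed
      qed
      then have C: "finite C"
        by (simp add: C_def eventually_cofinite)
      (* Outside the finite set C of exceptional points, G(b,z) is replaced by c G(a,z). *)
      have le: "u n b \<le> ennreal c * u n a + (\<Sum>z\<in>C. ennreal (green \<mu> b z) * v n z)" for n
      proof -
        have "u n b = (\<integral>\<^sup>+z. ennreal (green \<mu> b z) * v n z \<partial>count_space UNIV)"
          by (simp add: u_def potential_eq_sum_green[OF trans])
        also have "\<dots> \<le> (\<integral>\<^sup>+z. ennreal c * (ennreal (green \<mu> a z) * v n z)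
            + (ennreal (green \<mu> b z) * v n z) * indicator C z \<partial>count_space UNIV)"
        proof (rule nn_integral_mono)
          fix z
          show "ennreal (green \<mu> b z) * v n z \<le> ennreal c * (ennreal (green \<mu> a z) * v n z)
            + (ennreal (green \<mu> b z) * v n z) * indicator C z"
          proof (cases "z \<in> C")
            case False
            then have "ennreal (green \<mu> b z) \<le> ennreal c * ennreal (green \<mu> a z)"
              using c pos[of a z] by (simp add: C_def ennreal_leI flip: ennreal_mult)
            then show ?thesis
              using False by (simp add: mult_right_mono flip: mult.assoc)
          qed simp
        qed
        also have "\<dots> = ennreal c * u n a + (\<Sum>z\<in>C. ennreal (green \<mu> b z) * v n z)"
          using C by (simp add: nn_integral_add nn_integral_cmult nn_integral_indicator_finite
              u_def potential_eq_sum_green[OF trans])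
        finally show ?thesis .
      qed
      have "(\<lambda>n. ennreal c * u n a + (\<Sum>z\<in>C. ennreal (green \<mu> b z) * v n z))
          \<longlonglongrightarrow> ennreal c * ennreal (f a) + (\<Sum>z\<in>C. ennreal (green \<mu> b z) * 0)"
        by (intro tendsto_add tendsto_sum ennreal_tendsto_cmult u_lim v_lim) auto
      from LIMSEQ_le[OF u_lim this] le have "ennreal (f b) \<le> ennreal c * ennreal (f a)"
        by auto
      then show ?thesis
        using c f[of a] by (simp flip: ennreal_mult)
    qed
    show ?thesis
    proof (rule field_le_epsilon)
      fix e :: real
      assume "e > 0"
      then have "f b \<le> (1 + e / f a) * f a"
        using f[of a] by (intro approx) simp
      also have "\<dots> = f a + e"
        using f[of a] by (simp add: distrib_right)
      finally show "f b \<le> f a + e" .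
    qed
  qed
  then show ?thesis
    unfolding strong_liouville_def by (metis order_antisym)
qed

section \<open>The equivalence\<close>

theorem theoremA:
  fixes \<mu> :: "'a::group_add pmf" and T :: "'a set"
  assumes "infinite (UNIV :: 'a set)"
    and "finite_symmetric_generating T"
    and "nondegenerate \<mu>"
    and "transient \<mu>"
  shows "(symmetric_pmf \<mu> \<and> exp_moment_condition \<mu> \<and> strong_liouville \<mu> \<longrightarrow>
            (\<forall>a b F. exhaustion F \<longrightarrow> (\<lambda>n. green_variation \<mu> T (F n) a b) \<longlonglongrightarrow> 0))
       \<and> ((\<forall>a b F. exhaustion F \<longrightarrow> (\<lambda>n. green_variation \<mu> T (F n) a b) \<longlonglongrightarrow> 0) \<longrightarrow>
            strong_liouville \<mu>)"
proof -
  have pos: "green \<mu> x y > 0" for x y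
    by (rule green_pos[OF assms(3,4)])
  have variation_iff:
    "(\<forall>F. exhaustion F \<longrightarrow> (\<lambda>n. green_variation \<mu> T (F n) a b) \<longlonglongrightarrow> 0)
      \<longleftrightarrow> ((\<lambda>x. \<bar>green \<mu> a x - green \<mu> b x\<bar> / green \<mu> a x) \<longlongrightarrow> 0) cofinite" for a b
    unfolding green_variation_def
    by (rule boundary_maximum_tendsto_iff[OF assms(1,2)]) (simp add: less_imp_le[OF pos])
  have "strong_liouville \<mu>"
    if "\<And>a b. ((\<lambda>x. \<bar>green \<mu> a x - green \<mu> b x\<bar> / green \<mu> a x) \<longlongrightarrow> 0) cofinite"
    by (rule strong_liouville_if_green_ratio_tendsto[OF
          countable_if_finitely_generated[OF assms(2)] assms(4) pos that])
  then show ?thesis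
    using variation_iff green_ratio_tendsto_if_strong_liouville[OF assms(4) pos] by blast
qed

end
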